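(* Every incoherent operation (IO) acting on a single qutrit $\mathcal{H}_3$ admits a Kraus decomposition $\Phi(\rho)=\sum_{n=1}^N K_n\rho K_n^\dagger$ with at most $N=32$ incoherent Kraus operators.
   Context: Fix an orthonormal basis $\{|i\rangle\}_{i=1}^d$ of $\mathcal{H}_d$. A state is incoherent if it is diagonal in this basis, i.e. of the form $\delta=\sum_{i=1}^d\delta_i|i\rangle\langle i|$ with $\delta_i\ge 0$, $\sum_i\delta_i=1$; let $\mathcal{I}$ denote the set of incoherent states. A completely positive trace-preserving map $\Phi$ is an incoherent operation (IO) if it has a Kraus representation $\Phi(\rho)=\sum_n K_n\rho K_n^\dagger$, $\sum_n K_n^\dagger K_n=I$, such that $K_n\rho K_n^\dagger/\mathrm{Tr}[K_n\rho K_n^\dagger]\in\mathcal{I}$ for all $n$ and all $\rho\in\mathcal{I}$ (whenever the trace is nonzero); such Kraus operators are called incoherent Kraus operators (equivalently, each column of each $K_n$ has at most one nonzero entry). *)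

theory Defs
  imports "HOL-Analysis.Analysis"
begin

text \<open>Operators on the d-dimensional Hilbert space are d x d complex matrices
  (type complex^'n^'n, the index type 'n labelling the fixed incoherent basis).\<close>

definition adjoint :: "complex^'n^'m \<Rightarrow> complex^'m^'n" where
  "adjoint A = (\<chi> i j. cnj (A $ j $ i))"

definition incoherent_state :: "complex^'n^'n \<Rightarrow> bool" where
  "incoherent_state \<delta> \<longleftrightarrow>
     (\<forall>i j. i \<noteq> j \<longrightarrow> \<delta> $ i $ j = 0) \<and>
     (\<forall>i. \<delta> $ i $ i \<in> \<real> \<and> Re (\<delta> $ i $ i) \<ge> 0) \<and>
     (\<Sum>i\<in>UNIV. \<delta> $ i $ i) = 1"

definition incoherent_kraus :: "complex^'n^'n \<Rightarrow> bool" where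
  "incoherent_kraus K \<longleftrightarrow>
     (\<forall>\<delta>. incoherent_state \<delta> \<longrightarrow> trace (K ** \<delta> ** adjoint K) \<noteq> 0 \<longrightarrow>
        incoherent_state (\<chi> i j. (K ** \<delta> ** adjoint K) $ i $ j / trace (K ** \<delta> ** adjoint K)))"

definition kraus_rep :: "(complex^'n^'n \<Rightarrow> complex^'n^'n) \<Rightarrow> (complex^'n^'n) list \<Rightarrow> bool" where
  "kraus_rep \<Phi> Ks \<longleftrightarrow>
     (\<Sum>k\<leftarrow>Ks. adjoint k ** k) = mat 1 \<and>
     (\<forall>\<rho>. \<Phi> \<rho> = (\<Sum>k\<leftarrow>Ks. k ** \<rho> ** adjoint k))"

definition incoherent_operation :: "(complex^'n^'n \<Rightarrow> complex^'n^'n) \<Rightarrow> bool" where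
  "incoherent_operation \<Phi> \<longleftrightarrow>
     (\<exists>Ks. kraus_rep \<Phi> Ks \<and> (\<forall>k\<in>set Ks. incoherent_kraus k))"

end

theory Submission
  imports Defs
begin

text \<open>
  Group the Kraus operators by their column pattern \<open>f\<close>, which records the row of the nonzero entry
  of each column. The operators of pattern \<open>f\<close> contribute a positive 3 x 3 block \<open>M f\<close>, and the
  number of Kraus operators needed is the sum of the ranks of the 27 blocks. A positive matrix can be
  moved from block \<open>f\<close> to block \<open>g\<close> without changing the channel if it is supported on the
  coordinates where \<open>f\<close> and \<open>g\<close> agree.

  The 27 patterns are the ternary words of length 3, and five of them form a code of covering radius
  1. Let \<open>pivot f\<close> be the coordinate in which a word \<open>f\<close> outside the code differs from a chosen
  neighbouring code word, and minimise the linear functional of the diagonal entries with weight 0 on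
  code words, \<open>- 1\<close> at the pivot and \<open>1\<close> at the other coordinates of the remaining words. At a
  minimum the Schur complement of \<open>M f\<close> at its pivot vanishes for \<open>f\<close> outside the code, since it
  could be moved to the neighbour at a profit; so \<open>M f\<close> has rank at most 1. For a code word \<open>h\<close> some
  \<open>f\<close> outside the code agrees with \<open>h\<close> at the pivot of \<open>f\<close>, so no positive multiple of that
  coordinate projection can be split off \<open>M h\<close>, which therefore has rank at most 2. The total is
  at most 22 + 2 * 5 = 32.
\<close>

section \<open>Positive matrices as sums of dyads\<close>

definition outer :: "complex^'n \<Rightarrow> complex^'n^'n" where
  "outer v = (\<chi> j k. v $ j * cnj (v $ k))"

lemma outer_nth [simp]: "outer v $ j $ k = v $ j * cnj (v $ k)"
  by (simp add: outer_def)

lemma Re_outer: "Re (outer v $ j $ j) = (cmod (v $ j))\<^sup>2"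
  unfolding outer_nth complex_norm_square[symmetric] by simp

lemma outer_zero [simp]: "outer 0 = 0"
  by (simp add: vec_eq_iff)

text \<open>The sum is \<open>X X^*\<close> for the matrix \<open>X\<close> with columns
  \<open>u\<close> and \<open>v\<close>, so any 2 x 2 unitary may be applied to the pair. The
  coefficients are exposed because linear combinations keep the common zeros of \<open>u\<close> and
  \<open>v\<close>.\<close>

lemma givens_rotation:
  fixes u v :: "complex^'n"
  obtains \<alpha> \<beta> \<gamma> \<delta> where
    "outer u + outer v = outer (\<alpha> *s u + \<beta> *s v) + outer (\<gamma> *s u + \<delta> *s v)"
    "(\<gamma> *s u + \<delta> *s v) $ j = 0"
proof (cases "u $ j = 0 \<and> v $ j = 0")
  case True
  then show ?thesis
    by (intro that[of 1 0 0 1]) auto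
next
  case False
  define r where "r = sqrt ((cmod (u $ j))\<^sup>2 + (cmod (v $ j))\<^sup>2)"
  have r0: "r \<noteq> 0"
    using False by (simp add: r_def sum_power2_eq_zero_iff)
  define a b c where "a = u $ j" and "b = v $ j" and "c = complex_of_real r"
  have c0: "c \<noteq> 0" using r0 by (simp add: c_def)
  have "(r)\<^sup>2 = (cmod (u $ j))\<^sup>2 + (cmod (v $ j))\<^sup>2"
    by (simp add: r_def)
  then have "of_real (r\<^sup>2) = complex_of_real ((cmod a)\<^sup>2 + (cmod b)\<^sup>2)"
    by (simp add: a_def b_def)
  then have cc: "c * c = a * cnj a + b * cnj b"
    by (simp only: complex_norm_square of_real_add) (simp add: c_def power2_eq_square)
  have cnjc: "cnj c = c" by (simp add: c_def)
  \<comment> \<open>Unitarity of the 2 x 2 coefficient matrix, written out entrywise.\<close>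
  have key: "x * cnj x' + y * cnj y' =
     (cnj a / c * x + cnj b / c * y) * cnj (cnj a / c * x' + cnj b / c * y') +
     (b / c * x + (- a / c) * y) * cnj (b / c * x' + (- a / c) * y')" for x y x' y'
  proof -
    have "(cnj a / c * x + cnj b / c * y) * cnj (cnj a / c * x' + cnj b / c * y') +
     (b / c * x + (- a / c) * y) * cnj (b / c * x' + (- a / c) * y')
      = (a * cnj a + b * cnj b) * (x * cnj x' + y * cnj y') / (c * c)"
      using c0 by (simp add: cnjc field_simps)
    also have "\<dots> = x * cnj x' + y * cnj y'"
      using c0 by (simp flip: cc)
    finally show ?thesis by simp
  qed
  show ?thesis
  proof (rule that[of "cnj a / c" "cnj b / c" "b / c" "- a / c"])
    show "outer u + outer v = outer ((cnj a / c) *s u + (cnj b / c) *s v)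
        + outer ((b / c) *s u + (- a / c) *s v)"
      by (simp only: vec_eq_iff vector_add_component outer_nth vector_smult_component)
         (intro allI key)
    show "((b / c) *s u + (- a / c) *s v) $ j = 0"
      by (simp add: a_def b_def)
  qed
qed

text \<open>A Cholesky factorisation with prescribed pivot order, obtained by feeding in the dyads one
  at a time and rotating each new vector to zero against the current factor.\<close>

lemma sum_outer_triangular:
  fixes vs :: "(complex^'n) list" and j k l :: 'n
  assumes "UNIV = {j, k, l}"
  obtains u v w where
    "(\<Sum>x\<leftarrow>vs. outer x) = outer u + outer v + outer w" "v $ j = 0" "w $ j = 0" "w $ k = 0"
proof -
  have "\<exists>u v w. (\<Sum>x\<leftarrow>vs. outer x) = outer u + outer v + outer w
      \<and> v $ j = 0 \<and> w $ j = 0 \<and> w $ k = 0"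
  proof (induction vs)
    case Nil
    show ?case by (rule exI[of _ 0])+ simp
  next
    case (Cons x vs)
    then obtain u v w where uvw: "(\<Sum>x\<leftarrow>vs. outer x) = outer u + outer v + outer w"
      "v $ j = 0" "w $ j = 0" "w $ k = 0" by blast
    obtain u' x1 where 1: "outer u + outer x = outer u' + outer x1" "x1 $ j = 0"
      by (rule givens_rotation[of u x j])
    \<comment> \<open>Explicit coefficients are kept from here on: both vectors vanish at
      \<open>j\<close>, hence so do their combinations.\<close>
    obtain \<alpha> \<beta> \<gamma> \<delta> where 2: "outer v + outer x1 =
        outer (\<alpha> *s v + \<beta> *s x1) + outer (\<gamma> *s v + \<delta> *s x1)"
      "(\<gamma> *s v + \<delta> *s x1) $ k = 0"
      by (rule givens_rotation)
    define v' x2 where "v' = \<alpha> *s v + \<beta> *s x1" and "x2 = \<gamma> *s v + \<delta> *s x1"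
    have v': "v' $ j = 0" and x2: "x2 $ j = 0" "x2 $ k = 0"
      using uvw 1 2 by (simp_all add: v'_def x2_def)
    obtain \<alpha>' \<beta>' \<gamma>' \<delta>' where 3: "outer w + outer x2 =
        outer (\<alpha>' *s w + \<beta>' *s x2) + outer (\<gamma>' *s w + \<delta>' *s x2)"
      "(\<gamma>' *s w + \<delta>' *s x2) $ l = 0"
      by (rule givens_rotation)
    define w' x3 where "w' = \<alpha>' *s w + \<beta>' *s x2" and "x3 = \<gamma>' *s w + \<delta>' *s x2"
    have w': "w' $ j = 0" "w' $ k = 0" and x3: "x3 $ j = 0" "x3 $ k = 0" "x3 $ l = 0"
      using uvw x2 3 by (simp_all add: w'_def x3_def)
    have "x3 $ i = 0" for i
      using x3 assms by (metis UNIV_I empty_iff insertE)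
    then have "x3 = 0" by (simp add: vec_eq_iff)
    have "(\<Sum>x\<leftarrow>x # vs. outer x) = (outer u + outer x) + outer v + outer w"
      using uvw by simp
    also have "\<dots> = outer u' + (outer v + outer x1) + outer w"
      by (simp add: 1)
    also have "\<dots> = outer u' + outer v' + (outer w + outer x2)"
      unfolding 2 by (simp add: v'_def x2_def)
    also have "\<dots> = outer u' + outer v' + outer w'"
      unfolding 3 using \<open>x3 = 0\<close> by (simp add: w'_def x3_def)
    finally show ?case using v' w' by blast
  qed
  then show ?thesis using that by blast
qed

text \<open>These are exactly the positive semidefinite matrices.\<close>

definition dyad_sum :: "complex^'n^'n \<Rightarrow> bool" where
  "dyad_sum A \<longleftrightarrow> (\<exists>vs. A = (\<Sum>x\<leftarrow>vs. outer x))"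

lemma dyad_sum_add: "dyad_sum A \<Longrightarrow> dyad_sum B \<Longrightarrow> dyad_sum (A + B)"
  unfolding dyad_sum_def by (metis map_append sum_list_append)

lemma dyad_sum_outer: "dyad_sum (outer v)"
  unfolding dyad_sum_def by (rule exI[of _ "[v]"]) simp

lemma dyad_sum_sum:
  fixes V :: "complex^'n^3"
  shows "dyad_sum (\<Sum>i\<in>UNIV. outer (V $ i))"
  unfolding dyad_sum_def by (rule exI[of _ "[V $ 1, V $ 2, V $ 3]"]) (simp add: sum_3 add.assoc)

lemma dyad_sum_triangular:
  assumes "dyad_sum A" "UNIV = {j, k, l}"
  obtains u v w where "A = outer u + outer v + outer w" "v $ j = 0" "w $ j = 0" "w $ k = 0"
proof -
  obtain vs where "A = (\<Sum>x\<leftarrow>vs. outer x)"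
    using assms(1) unfolding dyad_sum_def by blast
  then show ?thesis
    using sum_outer_triangular[OF assms(2), of vs] that by metis
qed

section \<open>Incoherent Kraus operators and column patterns\<close>

text \<open>Every matrix with at most one nonzero entry per column has this form; \<open>f\<close>
  is free on columns where \<open>v\<close> vanishes.\<close>

definition pattern_kraus :: "('n \<Rightarrow> 'n) \<Rightarrow> complex^'n \<Rightarrow> complex^'n^'n" where
  "pattern_kraus f v = (\<chi> a j. if f j = a then v $ j else 0)"

lemma pattern_kraus_nth [simp]: "pattern_kraus f v $ a $ j = (if f j = a then v $ j else 0)"
  by (simp add: pattern_kraus_def)

lemma sandwich_nth:
  "(K ** \<rho> ** adjoint K) $ a $ b =
     (\<Sum>k\<in>UNIV. \<Sum>j\<in>UNIV. \<rho> $ j $ k * (K $ a $ j * cnj (K $ b $ k)))"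
  by (simp add: matrix_matrix_mult_def adjoint_def sum_distrib_right mult.assoc
      mult.left_commute)

lemma sandwich_diagonal_nth:
  assumes "\<And>i j. i \<noteq> j \<Longrightarrow> \<delta> $ i $ j = 0"
  shows "(K ** \<delta> ** adjoint K) $ a $ b = (\<Sum>j\<in>UNIV. \<delta> $ j $ j * (K $ a $ j * cnj (K $ b $ j)))"
  unfolding sandwich_nth
proof (rule sum.cong[OF refl])
  fix k
  have "(\<Sum>j\<in>UNIV. \<delta> $ j $ k * (K $ a $ j * cnj (K $ b $ k)))
      = (\<Sum>j\<in>{k}. \<delta> $ j $ k * (K $ a $ j * cnj (K $ b $ k)))"
    by (rule sum.mono_neutral_right) (use assms in auto)
  then show "(\<Sum>j\<in>UNIV. \<delta> $ j $ k * (K $ a $ j * cnj (K $ b $ k)))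
      = \<delta> $ k $ k * (K $ a $ k * cnj (K $ b $ k))" by simp
qed

text \<open>The basis state at \<open>j\<close> is sent to the dyad of column \<open>j\<close>,
  which is diagonal only if that column has at most one nonzero entry.\<close>

lemma incoherent_kraus_column:
  assumes "incoherent_kraus K" "a \<noteq> b"
  shows "K $ a $ j = 0 \<or> K $ b $ j = 0"
proof (rule ccontr)
  assume neg: "\<not> ?thesis"
  define \<delta> :: "complex^'a^'a" where "\<delta> = (\<chi> i k. if i = j \<and> k = j then 1 else 0)"
  have \<delta>: "incoherent_state \<delta>"
    by (simp add: incoherent_state_def \<delta>_def)
  have nth: "(K ** \<delta> ** adjoint K) $ c $ d = K $ c $ j * cnj (K $ d $ j)" for c d
    by (subst sandwich_diagonal_nth)
       (auto simp: \<delta>_def if_distrib[of "\<lambda>x. x * _"] cong: if_cong)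
  have "trace (K ** \<delta> ** adjoint K) = (\<Sum>c\<in>UNIV. K $ c $ j * cnj (K $ c $ j))"
    by (simp add: trace_def nth)
  also have "\<dots> = complex_of_real (\<Sum>c\<in>UNIV. (cmod (K $ c $ j))\<^sup>2)"
    by (simp add: complex_norm_square[symmetric])
  also have "\<dots> \<noteq> 0"
    using neg by (auto simp: sum_nonneg_eq_0_iff simp del: of_real_sum)
  finally have "trace (K ** \<delta> ** adjoint K) \<noteq> 0" .
  then have "(K ** \<delta> ** adjoint K) $ a $ b / trace (K ** \<delta> ** adjoint K) = 0"
    using assms \<delta> unfolding incoherent_kraus_def incoherent_state_def by auto
  then show False
    using \<open>trace _ \<noteq> 0\<close> neg by (simp add: nth)
qed

lemma incoherent_kraus_pattern:
  assumes "incoherent_kraus K"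
  obtains f v where "K = pattern_kraus f v"
proof -
  \<comment> \<open>A zero column gets an arbitrary row; \<open>v\<close> vanishes there.\<close>
  define f where "f j = (SOME a. K $ a $ j \<noteq> 0)" for j
  define v where "v = (\<chi> j. K $ f j $ j)"
  have "K $ a $ j = pattern_kraus f v $ a $ j" for a j
  proof (cases "K $ a $ j = 0")
    case True
    then show ?thesis by (auto simp: v_def)
  next
    case False
    then have "K $ f j $ j \<noteq> 0"
      unfolding f_def by (rule someI)
    then have "f j = a"
      using incoherent_kraus_column[OF assms] False by metis
    then show ?thesis by (auto simp: v_def)
  qed
  then have "K = pattern_kraus f v"
    unfolding vec_eq_iff by blast
  then show ?thesis by (rule that)
qed

text \<open>Distinct rows of the operator have disjoint supports, so a diagonal input has a diagonal
  output.\<close>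

lemma incoherent_kraus_pattern_kraus: "incoherent_kraus (pattern_kraus f v)"
  unfolding incoherent_kraus_def
proof (intro allI impI)
  fix \<delta> :: "complex^'a^'a"
  let ?K = "pattern_kraus f v"
  let ?S = "?K ** \<delta> ** adjoint ?K"
  assume \<delta>: "incoherent_state \<delta>" and tr: "trace ?S \<noteq> 0"
  define s where "s a = (\<Sum>j\<in>UNIV. Re (\<delta> $ j $ j) * (if f j = a then (cmod (v $ j))\<^sup>2 else 0))" for a
  have s: "s a \<ge> 0" for a
    using \<delta> unfolding s_def incoherent_state_def by (intro sum_nonneg) auto
  have re: "\<delta> $ j $ j = complex_of_real (Re (\<delta> $ j $ j))" for j
    using \<delta> unfolding incoherent_state_def by (simp add: of_real_Re)
  have S: "?S $ a $ b = (if a = b then complex_of_real (s a) else 0)" for a b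
  proof -
    have "?S $ a $ b = (\<Sum>j\<in>UNIV. \<delta> $ j $ j * (?K $ a $ j * cnj (?K $ b $ j)))"
      using \<delta> unfolding incoherent_state_def by (intro sandwich_diagonal_nth) auto
    also have "\<dots> = (if a = b then complex_of_real (s a) else 0)"
    proof (cases "a = b")
      case True
      have "\<delta> $ j $ j * (?K $ a $ j * cnj (?K $ b $ j)) = complex_of_real
          (Re (\<delta> $ j $ j) * (if f j = a then (cmod (v $ j))\<^sup>2 else 0))" for j
        using True re[of j] by (simp add: complex_norm_square[symmetric] del: of_real_power)
      then show ?thesis using True by (simp add: s_def)
    qed (auto intro!: sum.neutral)
    finally show ?thesis .
  qed
  have tr': "trace ?S = complex_of_real (\<Sum>a\<in>UNIV. s a)"
    by (simp add: trace_def S)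
  have "(\<Sum>i\<in>UNIV. ?S $ i $ i / trace ?S) = 1"
    using tr by (simp add: sum_divide_distrib[symmetric] trace_def)
  moreover have "?S $ i $ i / trace ?S = complex_of_real (s i / (\<Sum>a\<in>UNIV. s a))" for i
    by (simp add: S tr')
  ultimately show "incoherent_state (\<chi> i j. ?S $ i $ j / trace ?S)"
    unfolding incoherent_state_def using s
    by (auto simp: S sum_nonneg simp del: of_real_divide)
qed

lemma sum_list_nth_nth: "(\<Sum>x\<leftarrow>xs. A x) $ a $ b = (\<Sum>x\<leftarrow>xs. A x $ a $ b :: complex)"
  by (induction xs) auto

lemma sum_list_sum_swap:
  "(\<Sum>x\<leftarrow>xs. \<Sum>i\<in>I. g x i) = (\<Sum>i\<in>I. \<Sum>x\<leftarrow>xs. (g x i :: 'a::comm_monoid_add))"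
  by (induction xs) (auto simp: sum.distrib)

text \<open>The hypothesis says that the two families have the same Choi matrix.\<close>

lemma kraus_rep_cong:
  assumes "kraus_rep \<Phi> Ks"
    and choi: "\<And>a b j k. (\<Sum>K\<leftarrow>Ks. K $ a $ j * cnj (K $ b $ k)) = (\<Sum>K\<leftarrow>Ls. K $ a $ j * cnj (K $ b $ k))"
  shows "kraus_rep \<Phi> Ls"
proof -
  have 1: "(\<Sum>K\<leftarrow>Xs. adjoint K ** K) $ k $ j = (\<Sum>a\<in>UNIV. \<Sum>K\<leftarrow>Xs. K $ a $ j * cnj (K $ a $ k))"
    for Xs :: "(complex^'a^'a) list" and j k
    by (simp add: sum_list_nth_nth sum_list_sum_swap[symmetric] matrix_matrix_mult_def adjoint_def mult.commute)
  have 2: "(\<Sum>K\<leftarrow>Xs. K ** \<rho> ** adjoint K) $ a $ b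
      = (\<Sum>k\<in>UNIV. \<Sum>j\<in>UNIV. \<rho> $ j $ k * (\<Sum>K\<leftarrow>Xs. K $ a $ j * cnj (K $ b $ k)))"
    for Xs :: "(complex^'a^'a) list" and \<rho> a b
    by (simp add: sum_list_nth_nth sandwich_nth sum_list_sum_swap sum_list_const_mult)
  have "(\<Sum>K\<leftarrow>Ks. adjoint K ** K) = (\<Sum>K\<leftarrow>Ls. adjoint K ** K)"
    by (simp add: vec_eq_iff 1 choi)
  moreover have "(\<Sum>K\<leftarrow>Ks. K ** \<rho> ** adjoint K) = (\<Sum>K\<leftarrow>Ls. K ** \<rho> ** adjoint K)" for \<rho>
    by (simp add: vec_eq_iff 2 choi)
  ultimately show ?thesis
    using assms(1) by (simp add: kraus_rep_def)
qed

section \<open>Block families\<close>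

text \<open>All Kraus operators with column pattern \<open>f\<close> enter the Choi matrix only through the sum
  \<open>M f\<close> of the dyads of their coefficient vectors; \<open>choi M a b j k\<close> is the Choi matrix entry in
  row \<open>(a, j)\<close> and column \<open>(b, k)\<close>.\<close>

definition choi :: "(('n::finite \<Rightarrow> 'n) \<Rightarrow> complex^'n^'n) \<Rightarrow> 'n \<Rightarrow> 'n \<Rightarrow> 'n \<Rightarrow> 'n \<Rightarrow> complex" where
  "choi M a b j k = (\<Sum>f\<in>UNIV. if f j = a \<and> f k = b then M f $ j $ k else 0)"

definition cost :: "(('n::finite \<Rightarrow> 'n) \<Rightarrow> 'n \<Rightarrow> real) \<Rightarrow> (('n \<Rightarrow> 'n) \<Rightarrow> complex^'n^'n) \<Rightarrow> real" where
  "cost w M = (\<Sum>f\<in>UNIV. \<Sum>i\<in>UNIV. w f i * Re (M f $ i $ i))"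

lemma sum_fun_upd2:
  fixes F :: "'a::finite \<Rightarrow> 'b \<Rightarrow> 'c::ab_group_add"
  assumes "f \<noteq> g"
  shows "(\<Sum>h\<in>UNIV. F h ((M(f := x, g := y)) h)) =
    (\<Sum>h\<in>UNIV. F h (M h)) + (F f x - F f (M f)) + (F g y - F g (M g))"
proof -
  have "(\<Sum>h\<in>UNIV. F h ((M(f := x, g := y)) h)) - (\<Sum>h\<in>UNIV. F h (M h))
      = (\<Sum>h\<in>UNIV. F h ((M(f := x, g := y)) h) - F h (M h))"
    by (simp add: sum_subtractf)
  also have "\<dots> = (\<Sum>h\<in>{f, g}. F h ((M(f := x, g := y)) h) - F h (M h))"
    by (rule sum.mono_neutral_right) auto
  also have "\<dots> = (F f x - F f (M f)) + (F g y - F g (M g))"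
    using assms by simp
  finally show ?thesis by (simp add: algebra_simps)
qed

text \<open>\<open>D $ i $ k\<close> enters the Choi matrix in row \<open>(f i, i)\<close> and
  column \<open>(f k, k)\<close>, and this position is the same for \<open>g\<close>.\<close>

lemma choi_transfer:
  assumes "f \<noteq> g" "\<And>i k. D $ i $ k \<noteq> 0 \<Longrightarrow> f i = g i \<and> f k = g k"
  shows "choi (M(f := M f - D, g := M g + D)) = choi M"
proof (intro ext)
  fix a b j k
  show "choi (M(f := M f - D, g := M g + D)) a b j k = choi M a b j k"
    unfolding choi_def
    using sum_fun_upd2[OF assms(1), of "\<lambda>h A. if h j = a \<and> h k = b then A $ j $ k else 0" M "M f - D" "M g + D"]
      assms(2)[of j k]
    by (cases "D $ j $ k = 0") auto
qed

lemma cost_transfer: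
  assumes "f \<noteq> g"
  shows "cost w (M(f := M f - D, g := M g + D)) = cost w M + (\<Sum>i\<in>UNIV. (w g i - w f i) * Re (D $ i $ i))"
  unfolding cost_def
  using sum_fun_upd2[OF assms, of "\<lambda>h A. \<Sum>i\<in>UNIV. w h i * Re (A $ i $ i)" M "M f - D" "M g + D"]
  by (simp add: algebra_simps sum.distrib sum_subtractf)

text \<open>Applied twice: to collect the given Kraus operators into blocks, and to read a short
  list off the minimiser.\<close>

lemma choi_of_list:
  fixes ps :: "(('n::finite \<Rightarrow> 'n) \<times> (complex^'n)) list"
  shows "choi (\<lambda>f. \<Sum>p\<leftarrow>ps. if fst p = f then outer (snd p) else 0) a b j k =
    (\<Sum>p\<leftarrow>ps. pattern_kraus (fst p) (snd p) $ a $ j * cnj (pattern_kraus (fst p) (snd p) $ b $ k))"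
proof (induction ps)
  case Nil
  show ?case by (auto simp: choi_def intro!: sum.neutral)
next
  case (Cons p ps)
  let ?e = "\<lambda>f. if f = fst p then if f j = a \<and> f k = b then outer (snd p) $ j $ k else 0 else 0"
  let ?M = "\<lambda>f. \<Sum>p\<leftarrow>ps. if fst p = f then outer (snd p) else 0"
  have "choi (\<lambda>f. \<Sum>p\<leftarrow>p # ps. if fst p = f then outer (snd p) else 0) a b j k
      = (\<Sum>f\<in>UNIV. ?e f + (if f j = a \<and> f k = b then ?M f $ j $ k else 0))"
    unfolding choi_def by (rule sum.cong) auto
  also have "\<dots> = (\<Sum>f\<in>UNIV. ?e f) + choi ?M a b j k"
    unfolding choi_def by (rule sum.distrib)
  also have "(\<Sum>f\<in>UNIV. ?e f) = pattern_kraus (fst p) (snd p) $ a $ j * cnj (pattern_kraus (fst p) (snd p) $ b $ k)"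
    by (subst sum.delta) auto
  finally show ?case using Cons.IH by simp
qed

section \<open>Compactness and existence of a minimiser\<close>

lemma sum_choi_diagonal: "(\<Sum>j\<in>UNIV. \<Sum>a\<in>UNIV. choi M a a j j) = (\<Sum>f\<in>UNIV. \<Sum>j\<in>UNIV. M f $ j $ j)"
proof -
  have "(\<Sum>a\<in>UNIV. choi M a a j j) = (\<Sum>f\<in>UNIV. M f $ j $ j)" for j
    unfolding choi_def by (subst sum.swap) simp
  then show ?thesis by (simp only:) (rule sum.swap)
qed

lemma power2_norm_vec: "(norm (x :: 'a::real_normed_vector^'n))\<^sup>2 = (\<Sum>i\<in>UNIV. (norm (x $ i))\<^sup>2)"
  by (simp add: norm_vec_def L2_set_def sum_nonneg)

text \<open>Three dyads suffice for a positive 3 x 3 block, so families of blocks are parametrised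
  by a Euclidean space, where compactness is available.\<close>

definition blocks_of :: "complex^3^3^(3 \<Rightarrow> 3) \<Rightarrow> (3 \<Rightarrow> 3) \<Rightarrow> complex^3^3" where
  "blocks_of V f = (\<Sum>i\<in>UNIV. outer (V $ f $ i))"

lemma blocks_of_nth: "blocks_of V f $ j $ k = (\<Sum>i\<in>UNIV. V $ f $ i $ j * cnj (V $ f $ i $ k))"
  by (simp add: blocks_of_def)

lemma blocks_of_surj:
  assumes "\<And>f. dyad_sum (M f)"
  obtains V where "blocks_of V = M"
proof -
  have "\<exists>x :: complex^3^3. M f = (\<Sum>i\<in>UNIV. outer (x $ i))" for f
  proof -
    obtain u v w where "M f = outer u + outer v + outer w"
      by (rule dyad_sum_triangular[OF assms UNIV_3])
    then show ?thesis
      by (intro exI[of _ "\<chi> i. if i = 1 then u else if i = 2 then v else w"]) (simp add: sum_3)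
  qed
  then obtain x :: "(3 \<Rightarrow> 3) \<Rightarrow> complex^3^3" where "\<And>f. M f = (\<Sum>i\<in>UNIV. outer (x f $ i))"
    by metis
  then have "blocks_of (\<chi> f. x f) = M"
    by (auto simp: blocks_of_def)
  then show ?thesis by (rule that)
qed

text \<open>Both sides are the total trace of the blocks. Hence all parameters with a given Choi
  matrix lie on one sphere.\<close>

lemma power2_norm_eq_choi:
  "(norm V)\<^sup>2 = Re (\<Sum>j\<in>UNIV. \<Sum>a\<in>UNIV. choi (blocks_of V) a a j j)"
proof -
  have "(norm (V $ f))\<^sup>2 = (\<Sum>j\<in>UNIV. Re (blocks_of V f $ j $ j))" for f
  proof -
    have "(norm (V $ f))\<^sup>2 = (\<Sum>i\<in>UNIV. \<Sum>j\<in>UNIV. (cmod (V $ f $ i $ j))\<^sup>2)"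
      by (simp add: power2_norm_vec)
    also have "\<dots> = (\<Sum>j\<in>UNIV. \<Sum>i\<in>UNIV. (cmod (V $ f $ i $ j))\<^sup>2)"
      by (rule sum.swap)
    also have "\<dots> = (\<Sum>j\<in>UNIV. Re (blocks_of V f $ j $ j))"
      by (simp add: blocks_of_nth complex_norm_square[symmetric] cmod_power2 power2_eq_square)
    finally show ?thesis .
  qed
  then show ?thesis
    by (simp add: sum_choi_diagonal power2_norm_vec[of V])
qed

text \<open>The parameters with the given Choi matrix form a compact set, on which the continuous
  cost attains its minimum.\<close>

lemma ex_min_cost:
  fixes M\<^sub>0 :: "(3 \<Rightarrow> 3) \<Rightarrow> complex^3^3"
  assumes "\<And>f. dyad_sum (M\<^sub>0 f)"
  obtains M where "\<And>f. dyad_sum (M f)" "choi M = choi M\<^sub>0"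
    "\<And>N. (\<And>f. dyad_sum (N f)) \<Longrightarrow> choi N = choi M\<^sub>0 \<Longrightarrow> cost w M \<le> cost w N"
proof -
  define S where "S = {V. choi (blocks_of V) = choi M\<^sub>0}"
  have nth: "continuous_on UNIV (\<lambda>V. blocks_of V f $ j $ k)" for f j k
    unfolding blocks_of_nth by (intro continuous_intros)
  have "continuous_on UNIV (\<lambda>V. choi (blocks_of V) a b j k)" for a b j k
    unfolding choi_def
  proof (intro continuous_on_sum)
    fix f :: "3 \<Rightarrow> 3"
    show "continuous_on UNIV (\<lambda>V. if f j = a \<and> f k = b then blocks_of V f $ j $ k else 0)"
    proof (cases "f j = a \<and> f k = b")
      case True
      show ?thesis unfolding if_P[OF True] by (rule nth)
    next
      case False
      show ?thesis unfolding if_not_P[OF False] by (rule continuous_on_const)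
    qed
  qed
  then have "closed S"
    unfolding S_def fun_eq_iff
    by (intro closed_Collect_all closed_Collect_eq continuous_on_const)
  moreover have "bounded S"
    unfolding bounded_iff
  proof (intro exI ballI)
    fix V assume "V \<in> S"
    then have "(norm V)\<^sup>2 = Re (\<Sum>j\<in>UNIV. \<Sum>a\<in>UNIV. choi M\<^sub>0 a a j j)"
      by (simp only: power2_norm_eq_choi S_def mem_Collect_eq)
    then show "norm V \<le> sqrt (Re (\<Sum>j\<in>UNIV. \<Sum>a\<in>UNIV. choi M\<^sub>0 a a j j))"
      by (intro real_le_rsqrt) simp
  qed
  ultimately have "compact S"
    by (simp add: compact_eq_bounded_closed)
  moreover have "S \<noteq> {}"
  proof -
    obtain V where "blocks_of V = M\<^sub>0"
      using blocks_of_surj[of M\<^sub>0] assms by blast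
    then show ?thesis by (auto simp: S_def)
  qed
  moreover have "continuous_on S (\<lambda>V. cost w (blocks_of V))"
    unfolding cost_def
    by (intro continuous_intros continuous_on_subset[OF nth]) auto
  ultimately have "\<exists>V\<in>S. \<forall>W\<in>S. cost w (blocks_of V) \<le> cost w (blocks_of W)"
    by (rule continuous_attains_inf)
  then obtain V where V: "V \<in> S" "\<And>W. W \<in> S \<Longrightarrow> cost w (blocks_of V) \<le> cost w (blocks_of W)"
    by blast
  show ?thesis
  proof (rule that[of "blocks_of V"])
    show "dyad_sum (blocks_of V f)" for f
      unfolding blocks_of_def by (rule dyad_sum_sum)
    show "choi (blocks_of V) = choi M\<^sub>0"
      using V(1) by (simp add: S_def)
    fix N assume N: "\<And>f. dyad_sum (N f)" "choi N = choi M\<^sub>0"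
    obtain W where "blocks_of W = N"
      using N(1) by (rule blocks_of_surj)
    then show "cost w (blocks_of V) \<le> cost w N"
      using V(2)[of W] N(2) by (simp add: S_def)
  qed
qed

section \<open>A ternary covering code\<close>

definition word :: "3 \<Rightarrow> 3 \<Rightarrow> 3 \<Rightarrow> 3 \<Rightarrow> 3" where
  "word a b c i = (if i = 1 then a else if i = 2 then b else c)"

lemma word_simps [simp]: "word a b c 1 = a" "word a b c 2 = b" "word a b c 3 = c"
  by (simp_all add: word_def)

lemma eq_word_iff: "f = word a b c \<longleftrightarrow> f 1 = a \<and> f 2 = b \<and> f 3 = c"
  by (simp add: fun_eq_iff forall_3)

lemma word_eq_iff: "word a b c = word a' b' c' \<longleftrightarrow> a = a' \<and> b = b' \<and> c = c'"
  by (simp add: eq_word_iff)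

text \<open>The words over 1 and 2 with an even number of 2s, and the constant word 3.\<close>

definition cover :: "(3 \<Rightarrow> 3) set" where
  "cover = {word 3 3 3, word 1 1 1, word 1 2 2, word 2 1 2, word 2 2 1}"

text \<open>The odd one out among the three truth values \<open>f i = 3\<close>.\<close>

definition pivot :: "(3 \<Rightarrow> 3) \<Rightarrow> 3" where
  "pivot f = (if (f 2 = 3) = (f 3 = 3) then 1 else if (f 1 = 3) = (f 3 = 3) then 2 else 3)"

lemma card_cover: "card cover \<le> 5"
  unfolding cover_def by (intro card_insert_le_m1) auto

text \<open>If \<open>f\<close> has two 3s, the pivot is its other letter, which is changed to 3.
  Otherwise the pivot is the single 3, or coordinate 1 if there is none, and a letter 1 or 2 put
  there makes the parity even.\<close>

lemma cover_covers:
  assumes "f \<notin> cover"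
  obtains g where "g \<in> cover" "\<forall>i. i \<noteq> pivot f \<longrightarrow> f i = g i"
proof -
  have "\<forall>a b c. word a b c \<notin> cover \<longrightarrow>
      (\<exists>g\<in>cover. \<forall>i. i \<noteq> pivot (word a b c) \<longrightarrow> word a b c i = g i)"
    by (simp add: forall_3 cover_def word_eq_iff pivot_def)
  moreover have "f = word (f 1) (f 2) (f 3)"
    by (simp add: eq_word_iff)
  ultimately have "\<exists>g\<in>cover. \<forall>i. i \<noteq> pivot f \<longrightarrow> f i = g i"
    using assms by metis
  then show ?thesis using that by blast
qed

text \<open>In both witnesses the last two letters agree in being 3 or not, so the pivot is
  coordinate 1, where they copy \<open>h\<close>.\<close>

lemma cover_escape:
  assumes "h \<in> cover"
  obtains f where "f \<notin> cover" "f (pivot f) = h (pivot f)"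
proof (cases "h = word 3 3 3")
  case True
  then show ?thesis
    by (intro that[of "word 3 1 1"]) (auto simp: cover_def eq_word_iff pivot_def)
next
  case False
  then show ?thesis
    using assms
    by (intro that[of "word (h 1) 3 3"]) (auto simp: cover_def eq_word_iff pivot_def)
qed

text \<open>The signs reward two moves to or from a code word: leaving another word off its pivot,
  and entering it at its pivot.\<close>

definition weight :: "(3 \<Rightarrow> 3) \<Rightarrow> 3 \<Rightarrow> real" where
  "weight f i = (if f \<in> cover then 0 else if i = pivot f then - 1 else 1)"

section \<open>Rank bounds at a minimum\<close>

lemma ex_pivot_order: obtains k l where "UNIV = {j, k, l :: 3}"
  using exhaust_3[of j] that[of 2 3] that[of 1 3] that[of 1 2] by (auto simp: UNIV_3)

locale min_cost =
  fixes M :: "(3 \<Rightarrow> 3) \<Rightarrow> complex^3^3"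
  assumes dyad_sum: "dyad_sum (M f)"
    and minimal: "(\<And>f. dyad_sum (N f)) \<Longrightarrow> choi N = choi M \<Longrightarrow> cost weight M \<le> cost weight N"
begin

text \<open>First-order optimality: moving \<open>D\<close> from \<open>f\<close> to
  \<open>g\<close> keeps the blocks positive and the channel fixed, so it cannot lower the
  cost.\<close>

lemma transfer_ge:
  assumes "f \<noteq> g" "dyad_sum D" "dyad_sum (M f - D)"
    and "\<And>i k. D $ i $ k \<noteq> 0 \<Longrightarrow> f i = g i \<and> f k = g k"
  shows "(\<Sum>i\<in>UNIV. (weight g i - weight f i) * Re (D $ i $ i)) \<ge> 0"
proof -
  have "cost weight M \<le> cost weight (M(f := M f - D, g := M g + D))"
    using assms by (intro minimal choi_transfer) (auto simp: dyad_sum dyad_sum_add)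
  then show ?thesis using assms(1) by (simp add: cost_transfer)
qed

lemma rank_off_cover:
  assumes "f \<notin> cover"
  obtains u where "M f = outer u"
proof -
  obtain k l where kl: "UNIV = {pivot f, k, l}" by (rule ex_pivot_order)
  obtain u v w where uvw: "M f = outer u + outer v + outer w"
      "v $ pivot f = 0" "w $ pivot f = 0" "w $ k = 0"
    by (rule dyad_sum_triangular[OF dyad_sum kl])
  obtain g where g: "g \<in> cover" "\<forall>i. i \<noteq> pivot f \<longrightarrow> f i = g i"
    using assms by (rule cover_covers)
  \<comment> \<open>The pivot is eliminated first, so this remainder is supported where
    \<open>f\<close> and \<open>g\<close> agree.\<close>
  let ?D = "outer v + outer w"
  have D: "dyad_sum ?D" by (intro dyad_sum_add dyad_sum_outer)
  have "(\<Sum>i\<in>UNIV. (weight g i - weight f i) * Re (?D $ i $ i)) \<ge> 0"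
  proof (rule transfer_ge[OF _ D])
    show "f \<noteq> g" using assms g by blast
    show "dyad_sum (M f - ?D)"
      using dyad_sum_outer[of u] by (simp add: uvw(1) add.assoc)
    show "f i = g i \<and> f k = g k" if "?D $ i $ k \<noteq> 0" for i k
    proof -
      have "i \<noteq> pivot f" "k \<noteq> pivot f" using that uvw by auto
      then show ?thesis using g(2) by blast
    qed
  qed
  \<comment> \<open>Off the pivot the weight drops from 1 to 0; at the pivot \<open>v\<close> and
    \<open>w\<close> vanish.\<close>
  also have "(\<Sum>i\<in>UNIV. (weight g i - weight f i) * Re (?D $ i $ i))
      = - (\<Sum>i\<in>UNIV. (cmod (v $ i))\<^sup>2 + (cmod (w $ i))\<^sup>2)"
    unfolding sum_negf[symmetric]
  proof (rule sum.cong[OF refl])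
    fix i
    show "(weight g i - weight f i) * Re (?D $ i $ i) = - ((cmod (v $ i))\<^sup>2 + (cmod (w $ i))\<^sup>2)"
      using assms g(1) uvw(2,3)
      by (cases "i = pivot f") (auto simp: weight_def Re_outer simp del: outer_nth)
  qed
  finally have "(\<Sum>i\<in>UNIV. (cmod (v $ i))\<^sup>2 + (cmod (w $ i))\<^sup>2) \<le> 0" by simp
  then have "(\<Sum>i\<in>UNIV. (cmod (v $ i))\<^sup>2 + (cmod (w $ i))\<^sup>2) = 0"
    by (intro antisym sum_nonneg) auto
  then have "v = 0" "w = 0"
    by (auto simp: sum_nonneg_eq_0_iff vec_eq_iff add_nonneg_eq_0_iff)
  then show ?thesis using that uvw(1) by simp
qed

lemma rank_on_cover:
  assumes "h \<in> cover"
  obtains u v where "M h = outer u + outer v"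
proof -
  obtain f where f: "f \<notin> cover" "f (pivot f) = h (pivot f)"
    using assms by (rule cover_escape)
  obtain k l where kl: "UNIV = {pivot f, k, l}" by (rule ex_pivot_order)
  \<comment> \<open>Here the pivot comes last, so that \<open>w\<close> is supported on it
    alone.\<close>
  then have lk: "UNIV = {k, l, pivot f}" by auto
  obtain u v w where uvw: "M h = outer u + outer v + outer w" "v $ k = 0" "w $ k = 0" "w $ l = 0"
    by (rule dyad_sum_triangular[OF dyad_sum lk])
  have w0: "w $ i = 0" if "i \<noteq> pivot f" for i
    using uvw kl that by (metis UNIV_I empty_iff insertE)
  have "(\<Sum>i\<in>UNIV. (weight f i - weight h i) * Re (outer w $ i $ i)) \<ge> 0"
  proof (rule transfer_ge[OF _ dyad_sum_outer])
    show "h \<noteq> f" using assms f by blast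
    show "dyad_sum (M h - outer w)"
      using dyad_sum_add[OF dyad_sum_outer[of u] dyad_sum_outer[of v]] by (simp add: uvw(1))
    show "h i = f i \<and> h k = f k" if "outer w $ i $ k \<noteq> 0" for i k
    proof -
      have "i = pivot f" "k = pivot f" using that w0 by auto
      then show ?thesis using f by simp
    qed
  qed
  \<comment> \<open>At the pivot the weight drops from 0 to - 1.\<close>
  also have "(\<Sum>i\<in>UNIV. (weight f i - weight h i) * Re (outer w $ i $ i))
      = - (\<Sum>i\<in>UNIV. (cmod (w $ i))\<^sup>2)"
    unfolding sum_negf[symmetric]
  proof (rule sum.cong[OF refl])
    fix i
    show "(weight f i - weight h i) * Re (outer w $ i $ i) = - (cmod (w $ i))\<^sup>2"
      using assms f(1) w0[of i]
      by (cases "i = pivot f") (auto simp: weight_def Re_outer simp del: outer_nth)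
  qed
  finally have "(\<Sum>i\<in>UNIV. (cmod (w $ i))\<^sup>2) \<le> 0" by simp
  then have "(\<Sum>i\<in>UNIV. (cmod (w $ i))\<^sup>2) = 0"
    by (intro antisym sum_nonneg) auto
  then have "w = 0"
    by (auto simp: sum_nonneg_eq_0_iff vec_eq_iff)
  then show ?thesis using that uvw(1) by simp
qed

lemma few_dyads:
  "\<exists>vs. M f = (\<Sum>v\<leftarrow>vs. outer v) \<and> length vs \<le> (if f \<in> cover then 2 else 1)"
proof (cases "f \<in> cover")
  case True
  then obtain u v where "M f = outer u + outer v" by (rule rank_on_cover)
  then show ?thesis using True by (intro exI[of _ "[u, v]"]) auto
next
  case False
  then obtain u where "M f = outer u" by (rule rank_off_cover)
  then show ?thesis using False by (intro exI[of _ "[u]"]) auto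
qed

end

section \<open>Reading Kraus operators off the minimiser\<close>

theorem theorem1:
  fixes \<Phi> :: "complex^3^3 \<Rightarrow> complex^3^3"
  assumes "incoherent_operation \<Phi>"
  shows "\<exists>Ks. length Ks \<le> 32 \<and> kraus_rep \<Phi> Ks \<and> (\<forall>k\<in>set Ks. incoherent_kraus k)"
proof -
  obtain Ks where Ks: "kraus_rep \<Phi> Ks" "\<And>K. K \<in> set Ks \<Longrightarrow> incoherent_kraus K"
    using assms unfolding incoherent_operation_def by blast
  have "\<exists>p. K = pattern_kraus (fst p) (snd p)" if "K \<in> set Ks" for K
    using incoherent_kraus_pattern[OF Ks(2)[OF that]] by (metis fst_conv snd_conv)
  then obtain P where P: "\<And>K. K \<in> set Ks \<Longrightarrow> K = pattern_kraus (fst (P K)) (snd (P K))"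
    by metis
  \<comment> \<open>The blocks of the given operators, to each of which \<open>P\<close> assigns a
    pattern and a coefficient vector.\<close>
  define M\<^sub>0 where "M\<^sub>0 = (\<lambda>f. \<Sum>p\<leftarrow>map P Ks. if fst p = f then outer (snd p) else 0)"
  have M\<^sub>0: "choi M\<^sub>0 a b j k = (\<Sum>K\<leftarrow>Ks. K $ a $ j * cnj (K $ b $ k))" for a b j k
    unfolding M\<^sub>0_def choi_of_list
    by (intro arg_cong[of _ _ sum_list])
       (simp only: map_map map_eq_conv o_apply P[symmetric] cong: ball_cong, simp)
  have "dyad_sum (\<Sum>p\<leftarrow>ps. if fst p = f then outer (snd p) else 0)"
    for ps :: "((3 \<Rightarrow> 3) \<times> (complex^3)) list" and f
    unfolding dyad_sum_def
    by (rule exI[of _ "map snd (filter (\<lambda>p. fst p = f) ps)"]) (induction ps, auto)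
  then have dyad_M\<^sub>0: "dyad_sum (M\<^sub>0 f)" for f
    by (simp only: M\<^sub>0_def)
  obtain M where M: "\<And>f. dyad_sum (M f)" "choi M = choi M\<^sub>0"
    "\<And>N. (\<And>f. dyad_sum (N f)) \<Longrightarrow> choi N = choi M\<^sub>0 \<Longrightarrow> cost weight M \<le> cost weight N"
    using ex_min_cost[of M\<^sub>0 weight, OF dyad_M\<^sub>0] by metis
  interpret min_cost M
  proof
    show "dyad_sum (M f)" for f by (rule M(1))
    show "cost weight M \<le> cost weight N" if "\<And>f. dyad_sum (N f)" "choi N = choi M" for N
      using that(2) by (intro M(3) that(1)) (simp only: M(2))
  qed
  have "\<exists>L. \<forall>f. M f = (\<Sum>v\<leftarrow>L f. outer v) \<and> length (L f) \<le> (if f \<in> cover then 2 else 1)"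
    by (intro choice allI few_dyads)
  then obtain L where L: "\<And>f. M f = (\<Sum>v\<leftarrow>L f. outer v)"
      "\<And>f. length (L f) \<le> (if f \<in> cover then 2 else 1)"
    by blast
  obtain fs :: "(3 \<Rightarrow> 3) list" where fs: "set fs = UNIV" "distinct fs"
    using finite_distinct_list[OF finite] by blast
  \<comment> \<open>Each dyad of the block \<open>M f\<close> yields one Kraus operator of pattern
    \<open>f\<close>.\<close>
  define ps where "ps = concat (map (\<lambda>f. map (Pair f) (L f)) fs)"
  define Ls where "Ls = map (\<lambda>p. pattern_kraus (fst p) (snd p)) ps"
  have "(\<Sum>p\<leftarrow>ps. if fst p = f then outer (snd p) else 0) = M f" for f
  proof -
    have "(\<Sum>p\<leftarrow>ps. if fst p = f then outer (snd p) else 0) =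
        (\<Sum>g\<leftarrow>fs. \<Sum>v\<leftarrow>L g. if g = f then outer v else 0)"
      unfolding ps_def by (induction fs) (simp_all add: comp_def cong: if_cong)
    also have "\<dots> = (\<Sum>g\<in>UNIV. \<Sum>v\<leftarrow>L g. if g = f then outer v else 0)"
      by (simp add: fs sum_list_distinct_conv_sum_set)
    also have "\<dots> = (\<Sum>g\<in>UNIV. if g = f then M f else 0)"
      by (rule sum.cong) (auto simp: L(1))
    finally show ?thesis by simp
  qed
  then have choi_M: "choi M a b j k = (\<Sum>K\<leftarrow>Ls. K $ a $ j * cnj (K $ b $ k))" for a b j k
    using choi_of_list[of ps a b j k] by (simp add: Ls_def comp_def)
  have "kraus_rep \<Phi> Ls"
    by (rule kraus_rep_cong[OF Ks(1)]) (simp only: M(2) flip: M\<^sub>0 choi_M)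
  moreover have "length Ls \<le> 32"
  proof -
    have "length Ls = (\<Sum>f\<leftarrow>fs. length (L f))"
      by (simp add: Ls_def ps_def length_concat comp_def)
    also have "\<dots> = (\<Sum>f\<in>UNIV. length (L f))"
      by (simp add: fs sum_list_distinct_conv_sum_set)
    also have "\<dots> \<le> (\<Sum>f\<in>UNIV. 1 + (if f \<in> cover then 1 else 0))"
      by (rule sum_mono, rule order_trans[OF L(2)]) simp
    \<comment> \<open>There are 27 patterns, and the at most 5 code words count twice.\<close>
    also have "\<dots> = card (UNIV :: (3 \<Rightarrow> 3) set) + card cover"
      unfolding sum.distrib by (simp only: sum.If_cases finite) simp
    also have "\<dots> \<le> 32"
      using card_cover unfolding card_fun by simp
    finally show ?thesis .
  qed
  moreover have "incoherent_kraus K" if "K \<in> set Ls" for K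
    using that by (auto simp: Ls_def incoherent_kraus_pattern_kraus)
  ultimately show ?thesis by blast
qed

end
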